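(* There exists a universal constant $c_0>0$, and for each $\alpha\in(0,1)$ constants $C,C'>0$ depending only on $\alpha$, such that for all integers $n\ge1$ and all $\epsilon_{\max}\in[0,1]$ with $\frac{\log(2/\alpha)}n+\epsilon_{\max}\le c_0$, the estimator $\widehat p$ defined in the context satisfies $$\inf_{p\in[0,1]}\ \inf_{P\in\mathcal G(n,p,\epsilon_{\max})}P\left(|\widehat p-p|\le C\Big(\sqrt{\tfrac{p(1-p)}n}+\tfrac1n\Big)\right)\ge1-\alpha.$$ Consequently, the interval $\widehat{\mathrm{CI}}=\Big\{p\in[0,1]:|\widehat p-p|\le C\Big(\sqrt{\tfrac{p(1-p)}n}+\tfrac1n\Big)\Big\}$ satisfies $$\inf_{p\in[0,1]}\ \inf_{P\in\mathcal G(n,p,\epsilon_{\max})}P\big(p\in\widehat{\mathrm{CI}}\big)\ge1-\alpha,$$ $$\inf_{\epsilon\in[0,\epsilon_{\max}],\,p\in[0,1]}\ \inf_{P\in\mathcal G(n,p,\epsilon)}P\left(|\widehat{\mathrm{CI}}|\le C'\Big(\sqrt{\tfrac{p(1-p)}n}+\tfrac1n\Big)\right)\ge1-\alpha.$$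
   Context: Erdős–Rényi model with node contamination: for $n\ge1$, $p,\epsilon\in[0,1]$, $\mathcal G(n,p,\epsilon)$ is the set of all distributions $P$ of a symmetric adjacency matrix $A\in\{0,1\}^{n\times n}$ with zero diagonal generated as follows. (1) Sample $z_1,\dots,z_n$ i.i.d. $\mathrm{Bernoulli}(\epsilon)$. (2) Conditionally on $(z_i)$, sample $\{A_{ij}\}_{1\le i<j\le n}$ independently: $A_{ij}\sim\mathrm{Bernoulli}(p)$ if $z_i=z_j=0$, and otherwise $A_{ij}$ is drawn from an arbitrary Bernoulli distribution (whose parameter may depend on $i,j$ and on $(z_i)$). Set $A_{ji}=A_{ij}$, $A_{ii}=0$. Norm: $J\in\mathbb R^{n\times n}$ is the all-ones matrix, $I$ the identity, and for $B\in\mathbb R^{n\times n}$ and $S\subset\{1,\dots,n\}$, $B_{S\times S}\in\mathbb R^{n\times n}$ is obtained from $B$ by setting to zero all entries outside $S\times S$. Let $\mathcal U=\{(J-I)_{S\times S}:S\subset\{1,\dots,n\}\}$ and $\|B\|_{\mathcal U}=\sup_{U\in\mathcal U}|\langle B,U\rangle|$ with $\langle B,U\rangle=\sum_{i,j}B_{ij}U_{ij}$. Estimator: for $S\subset\{1,\dots,n\}$ put $\widehat p_S=\frac1{\#S(\#S-1)}\sum_{i\in S}\sum_{j\in S}A_{ij}$; let $\widehat S$ be a minimizer of $\big\|(A-\widehat p_SJ)_{S\times S}\big\|_{\mathcal U}$ over $S\subset\{1,\dots,n\}$ with $\#S\ge\frac{3n}4$; and set $\widehat p=\widehat p_{\widehat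 S}$. $|\widehat{\mathrm{CI}}|$ denotes the length of the interval. *)

theory Defs
  imports "HOL-Probability.Probability"
begin

text \<open>
  The dimension \<open>n\<close> is quantified inside the theorem, so an \<open>n \<times> n\<close> real matrix is a function
  on \<open>nat \<times> nat\<close> of which only the entries with indices in \<open>{1..n}\<close> are used.
\<close>

type_synonym matr = "nat \<Rightarrow> nat \<Rightarrow> real"

definition ones_mat :: matr where
  "ones_mat = (\<lambda>i j. 1)"

definition id_mat :: matr where
  "id_mat = (\<lambda>i j. if i = j then 1 else 0)"

definition restrict_mat :: "nat set \<Rightarrow> matr \<Rightarrow> matr" where
  "restrict_mat S B = (\<lambda>i j. if i \<in> S \<and> j \<in> S then B i j else 0)"

definition inner_mat :: "nat \<Rightarrow> matr \<Rightarrow> matr \<Rightarrow> real" where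
  "inner_mat n B U = (\<Sum>i\<in>{1..n}. \<Sum>j\<in>{1..n}. B i j * U i j)"

definition test_mats :: "nat \<Rightarrow> matr set" where
  "test_mats n = {restrict_mat S (\<lambda>i j. ones_mat i j - id_mat i j) | S. S \<subseteq> {1..n}}"

definition norm_U :: "nat \<Rightarrow> matr \<Rightarrow> real" where
  "norm_U n B = (SUP U\<in>test_mats n. \<bar>inner_mat n B U\<bar>)"

definition adjacency :: "nat \<Rightarrow> matr \<Rightarrow> bool" where
  "adjacency n A \<longleftrightarrow>
     (\<forall>i j. A i j \<in> {0, 1}) \<and> (\<forall>i j. A i j = A j i) \<and> (\<forall>i. A i i = 0) \<and>
     (\<forall>i j. \<not> (i \<in> {1..n} \<and> j \<in> {1..n}) \<longrightarrow> A i j = 0)"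

definition pairs :: "nat \<Rightarrow> (nat \<times> nat) set" where
  "pairs n = {(i, j). 1 \<le> i \<and> i < j \<and> j \<le> n}"

definition mat_of_edges :: "(nat \<times> nat \<Rightarrow> bool) \<Rightarrow> matr" where
  "mat_of_edges E = (\<lambda>i j. of_bool (i < j \<and> E (i, j) \<or> j < i \<and> E (j, i)))"

text \<open>
  The value \<open>z i = True\<close> marks node \<open>i\<close> as contaminated; \<open>q z i j\<close> is the parameter the
  adversary chooses for the pair \<open>(i, j)\<close> after seeing all of \<open>z\<close>.
\<close>

definition contaminated_ER ::
  "nat \<Rightarrow> real \<Rightarrow> real \<Rightarrow> ((nat \<Rightarrow> bool) \<Rightarrow> nat \<Rightarrow> nat \<Rightarrow> real) \<Rightarrow> matr pmf" where
  "contaminated_ER n p \<epsilon> q =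
     bind_pmf (Pi_pmf {1..n} False (\<lambda>_. bernoulli_pmf \<epsilon>)) (\<lambda>z.
       map_pmf mat_of_edges
         (Pi_pmf (pairs n) False
           (\<lambda>(i, j). bernoulli_pmf (if \<not> z i \<and> \<not> z j then p else q z i j))))"

definition ER_class :: "nat \<Rightarrow> real \<Rightarrow> real \<Rightarrow> matr pmf set" where
  "ER_class n p \<epsilon> = {contaminated_ER n p \<epsilon> q | q. \<forall>z i j. q z i j \<in> {0..1}}"

definition p_hat_on :: "matr \<Rightarrow> nat set \<Rightarrow> real" where
  "p_hat_on A S = 1 / (real (card S) * (real (card S) - 1)) * (\<Sum>i\<in>S. \<Sum>j\<in>S. A i j)"

text \<open>
  The minimizer need not be unique, so \<open>\<S>\<close> ranges over all rules choosing, as a function of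
  the observed adjacency matrix, one of the minimizers.
\<close>

definition minimizer_rule :: "nat \<Rightarrow> (matr \<Rightarrow> nat set) \<Rightarrow> bool" where
  "minimizer_rule n \<S> \<longleftrightarrow>
     (\<forall>A. adjacency n A \<longrightarrow>
        is_arg_min
          (\<lambda>S. norm_U n (restrict_mat S (\<lambda>i j. A i j - p_hat_on A S * ones_mat i j)))
          (\<lambda>S. S \<subseteq> {1..n} \<and> real (card S) \<ge> 3 * real n / 4)
          (\<S> A))"

definition p_hat :: "(matr \<Rightarrow> nat set) \<Rightarrow> matr \<Rightarrow> real" where
  "p_hat \<S> A = p_hat_on A (\<S> A)"

definition rate :: "nat \<Rightarrow> real \<Rightarrow> real" where
  "rate n p = sqrt (p * (1 - p) / real n) + 1 / real n"

definition CI_hat :: "nat \<Rightarrow> real \<Rightarrow> (matr \<Rightarrow> nat set) \<Rightarrow> matr \<Rightarrow> real set" where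
  "CI_hat n C \<S> A = {p \<in> {0..1}. \<bar>p_hat \<S> A - p\<bar> \<le> C * rate n p}"

text \<open>
  For \<open>C \<ge> 0\<close> the set \<open>CI_hat n C \<S> A\<close> is a closed interval (a convex function of \<open>p\<close> is bounded
  by a concave one), so its length is its Lebesgue measure.
\<close>

definition CI_length :: "real set \<Rightarrow> real" where
  "CI_length X = measure lborel X"

end

theory Submission
  imports Defs
begin

text \<open>
  Write \<open>G\<close> for the set of clean nodes and \<open>t = 8 n\<^sup>2 \<cdot> rate n p\<close>. Two events carry the proof.

  \<^item> At least \<open>7n/8\<close> nodes are clean (\<open>few_contaminated\<close>).
  \<^item> For every \<open>T \<subseteq> G\<close> the off-diagonal sum of \<open>A - p\<close> over \<open>T \<times> T\<close> is at most \<open>t\<close> in absolute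
    value (\<open>clean_subgraphs_concentrate\<close>). Given the labels, such a sum is twice a centred
    Bernoulli sum, whose exponential tail is governed by its variance; the scale \<open>t\<close> is chosen so
    that a union bound over the at most \<open>2^n\<close> sets \<open>T\<close> still leaves probability \<open>exp (- n)\<close>.

  On these events a deterministic comparison bounds the error (\<open>p_hat_error_bound\<close>). The set \<open>G\<close>
  is a competitor in the minimization, and its objective is at most \<open>2t\<close>: one \<open>t\<close> for the noise
  around \<open>p\<close>, another for the error of \<open>p_hat_on A G\<close>. Hence the minimizer \<open>S\<close> has objective at most
  \<open>2t\<close> too. Restricting it to \<open>T = S \<inter> G\<close>, which has at least \<open>5n/8\<close> elements, the sums over
  \<open>T \<times> T\<close> of \<open>A\<close> minus the estimate and of \<open>A - p\<close> differ by at most \<open>3t\<close>, that is,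
  \<open>|T| (|T| - 1) |p_hat - p| \<le> 3t\<close>, so the error is a constant multiple of \<open>rate n p\<close>. Both
  exceptional probabilities are exponentially small in \<open>n\<close>, and \<open>n \<ge> 100 ln (2 / \<alpha>)\<close> makes their
  sum at most \<open>\<alpha>\<close>; the constants \<open>C\<close> and \<open>C'\<close> therefore need not depend on \<open>\<alpha>\<close>.

  The length of the interval is bounded on the same event, because \<open>p (1 - p)\<close> is 1-Lipschitz in
  \<open>p\<close>: all points \<open>x\<close> of the interval have \<open>rate n x\<close> comparable to \<open>rate n p\<close> up to a term that can
  be absorbed into \<open>|x - p|\<close>.
\<close>
section \<open>Exponential tail bounds for independent Bernoulli variables\<close>

lemma exp_le_quadratic:
  fixes x :: real
  assumes "x \<le> 1"
  shows "exp x \<le> 1 + x + x\<^sup>2"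
proof (cases "x \<ge> 0")
  case True
  then show ?thesis using exp_bound assms by simp
next
  case False
  have "0 \<le> - (x ^ 3)"
    using False power_less_zero_eq[of x 3] by simp
  \<comment> \<open>the product is \<open>1 - x\<^sup>3\<close>\<close>
  then have "1 \<le> (1 - x) * (1 + x + x\<^sup>2)"
    by (simp add: algebra_simps power2_eq_square power3_eq_cube)
  also have "\<dots> \<le> exp (- x) * (1 + x + x\<^sup>2)"
  proof (rule mult_right_mono)
    have "0 \<le> (2 * x + 1)\<^sup>2" by simp
    then show "0 \<le> 1 + x + x\<^sup>2" by (simp add: power2_eq_square algebra_simps)
  qed (use exp_ge_add_one_self[of "- x"] in simp)
  finally show ?thesis
    by (simp add: exp_minus field_simps)
qed

lemma bernoulli_mgf_bound:
  fixes p l :: real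
  assumes p: "p \<in> {0..1}" and l: "\<bar>l\<bar> \<le> 1"
  shows "measure_pmf.expectation (bernoulli_pmf p) (\<lambda>b. exp (l * (of_bool b - p)))
           \<le> exp (l\<^sup>2 * (p * (1 - p)))"
proof -
  have le1: "l * y \<le> 1" if "\<bar>y\<bar> \<le> 1" for y
  proof -
    have "\<bar>l * y\<bar> \<le> 1 * 1"
      unfolding abs_mult using l that by (intro mult_mono) auto
    then show ?thesis by simp
  qed
  have "measure_pmf.expectation (bernoulli_pmf p) (\<lambda>b. exp (l * (of_bool b - p)))
      = exp (l * (1 - p)) * p + exp (l * (- p)) * (1 - p)"
    using p by simp
  also have "\<dots> \<le> (1 + l * (1 - p) + (l * (1 - p))\<^sup>2) * p + (1 + l * (- p) + (l * (- p))\<^sup>2) * (1 - p)"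
    by (intro add_mono mult_right_mono exp_le_quadratic le1) (use p in auto)
  also have "\<dots> = 1 + l\<^sup>2 * (p * (1 - p))"
    by (simp add: power2_eq_square algebra_simps)
  also have "\<dots> \<le> exp (l\<^sup>2 * (p * (1 - p)))"
    by (rule exp_ge_add_one_self)
  finally show ?thesis .
qed

text \<open>
  Only the coordinates in \<open>D\<close> need to be Bernoulli with the common parameter \<open>p\<close>; the others may be
  arbitrary, as are the edges at contaminated nodes. The exponential rate \<open>l\<close> is kept free so that it
  can be tuned to the variance \<open>p (1 - p)\<close>.
\<close>

lemma Pi_pmf_bernoulli_tail:
  fixes p l a :: real and P :: "'a \<Rightarrow> bool pmf"
  assumes "finite I" and "D \<subseteq> I" and P: "\<And>e. e \<in> D \<Longrightarrow> P e = bernoulli_pmf p"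
    and p: "p \<in> {0..1}" and l: "\<bar>l\<bar> \<le> 1"
  shows "measure_pmf.prob (Pi_pmf I False P) {x. a \<le> l * (\<Sum>e\<in>D. of_bool (x e) - p)}
           \<le> exp (l\<^sup>2 * (real (card D) * (p * (1 - p))) - a)"
proof -
  define M where "M = Pi_pmf I False P"
  define u where "u = (\<lambda>x. exp (l * (\<Sum>e\<in>D. of_bool (x e) - p)))"
  define f where "f = (\<lambda>e b. if e \<in> D then exp (l * (of_bool b - p)) else 1)"
  have "finite D" using assms finite_subset by blast
  have "finite (set_pmf M)"
    unfolding M_def using \<open>finite I\<close> by (auto simp: set_Pi_pmf intro!: finite_PiE_dflt)
  then have int: "integrable M u" by (rule integrable_measure_pmf_finite)
  have u_eq: "u x = (\<Prod>e\<in>I. f e (x e))" for x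
  proof -
    have "u x = (\<Prod>e\<in>D. exp (l * (of_bool (x e) - p)))"
      unfolding u_def by (simp add: sum_distrib_left exp_sum \<open>finite D\<close>)
    also have "\<dots> = (\<Prod>e\<in>D. f e (x e))"
      by (simp add: f_def)
    also have "\<dots> = (\<Prod>e\<in>I. f e (x e))"
      using \<open>finite I\<close> \<open>D \<subseteq> I\<close> by (intro prod.mono_neutral_left) (auto simp: f_def)
    finally show ?thesis .
  qed
  have "measure_pmf.expectation M u = (\<Prod>e\<in>I. measure_pmf.expectation (P e) (f e))"
    unfolding u_eq M_def
    by (rule expectation_prod_Pi_pmf) (auto simp: f_def \<open>finite I\<close> intro!: integrable_measure_pmf_finite)
  also have "\<dots> = (\<Prod>e\<in>D. measure_pmf.expectation (P e) (f e))"
    using \<open>finite I\<close> \<open>D \<subseteq> I\<close> by (intro prod.mono_neutral_right) (auto simp: f_def)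
  also have "\<dots> \<le> (\<Prod>e\<in>D. exp (l\<^sup>2 * (p * (1 - p))))"
    using bernoulli_mgf_bound[OF p l]
    by (intro prod_mono) (auto simp: f_def P intro!: integral_nonneg)
  also have "\<dots> = exp (l\<^sup>2 * (real (card D) * (p * (1 - p))))"
    by (simp flip: exp_of_nat_mult add: mult_ac)
  finally have mgf: "measure_pmf.expectation M u \<le> exp (l\<^sup>2 * (real (card D) * (p * (1 - p))))" .
  have "measure_pmf.prob M {x. a \<le> l * (\<Sum>e\<in>D. of_bool (x e) - p)}
      = measure_pmf.prob M {x \<in> space M. exp a \<le> u x}"
    by (simp add: u_def)
  also have "\<dots> \<le> measure_pmf.expectation M u / exp a"
    by (rule integral_Markov_inequality_measure[where A = "{}"]) (use int in \<open>auto simp: u_def\<close>)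
  also have "\<dots> \<le> exp (l\<^sup>2 * (real (card D) * (p * (1 - p))) - a)"
    using mgf by (simp add: exp_diff divide_right_mono)
  finally show ?thesis unfolding M_def .
qed

corollary Pi_pmf_bernoulli_abs_tail:
  fixes p l a :: real and P :: "'a \<Rightarrow> bool pmf"
  assumes "finite I" and "D \<subseteq> I" and "\<And>e. e \<in> D \<Longrightarrow> P e = bernoulli_pmf p"
    and "p \<in> {0..1}" and "0 \<le> l" "l \<le> 1"
  shows "measure_pmf.prob (Pi_pmf I False P) {x. a \<le> l * \<bar>\<Sum>e\<in>D. of_bool (x e) - p\<bar>}
           \<le> 2 * exp (l\<^sup>2 * (real (card D) * (p * (1 - p))) - a)"
proof -
  let ?M = "Pi_pmf I False P" and ?s = "\<lambda>x. \<Sum>e\<in>D. of_bool (x e) - p"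
  have "{x. a \<le> l * \<bar>?s x\<bar>} \<subseteq> {x. a \<le> l * ?s x} \<union> {x. a \<le> - l * ?s x}"
    by (auto simp: abs_if split: if_splits)
  then have "measure_pmf.prob ?M {x. a \<le> l * \<bar>?s x\<bar>}
      \<le> measure_pmf.prob ?M ({x. a \<le> l * ?s x} \<union> {x. a \<le> - l * ?s x})"
    by (intro measure_pmf.finite_measure_mono) auto
  also have "\<dots> \<le> measure_pmf.prob ?M {x. a \<le> l * ?s x} + measure_pmf.prob ?M {x. a \<le> - l * ?s x}"
    by (rule measure_Un_le) auto
  also have "\<dots> \<le> exp (l\<^sup>2 * (real (card D) * (p * (1 - p))) - a)
      + exp ((- l)\<^sup>2 * (real (card D) * (p * (1 - p))) - a)"
    using assms by (intro add_mono Pi_pmf_bernoulli_tail) auto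
  finally show ?thesis by simp
qed

section \<open>Stability of the minimizer\<close>

text \<open>
  The inner product of a matrix with \<open>(J - I)\<close> restricted to \<open>T \<times> T\<close>, that is, its sum over the
  ordered pairs of distinct elements of \<open>T\<close>.
\<close>

definition offdiag_sum :: "nat set \<Rightarrow> matr \<Rightarrow> real" where
  "offdiag_sum T B = (\<Sum>i\<in>T. \<Sum>j\<in>T - {i}. B i j)"

lemma inner_mat_test_mat:
  assumes "S \<subseteq> {1..n}" and "T \<subseteq> {1..n}"
  shows "inner_mat n (restrict_mat S B) (restrict_mat T (\<lambda>i j. ones_mat i j - id_mat i j))
           = offdiag_sum (S \<inter> T) B"
proof -
  have "(\<Sum>j\<in>{1..n}. restrict_mat S B i j * restrict_mat T (\<lambda>i j. ones_mat i j - id_mat i j) i j)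
     = (if i \<in> S \<inter> T then \<Sum>j\<in>S \<inter> T - {i}. B i j else 0)" for i
  proof (cases "i \<in> S \<inter> T")
    case True
    have "(\<Sum>j\<in>{1..n}. restrict_mat S B i j * restrict_mat T (\<lambda>i j. ones_mat i j - id_mat i j) i j)
       = (\<Sum>j\<in>S \<inter> T - {i}. B i j)"
      by (rule sum.mono_neutral_cong_right)
         (use True assms in \<open>auto simp: restrict_mat_def ones_mat_def id_mat_def split: if_splits\<close>)
    with True show ?thesis by simp
  qed (auto simp: restrict_mat_def)
  then show ?thesis
    using assms unfolding inner_mat_def offdiag_sum_def
    by (auto intro!: sum.mono_neutral_cong_right split: if_splits)
qed

lemma finite_test_mats: "finite (test_mats n)"
  unfolding test_mats_def by simp

lemma test_mats_nonempty: "test_mats n \<noteq> {}"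
  unfolding test_mats_def by auto

lemma offdiag_sum_le_norm_U:
  assumes "S \<subseteq> {1..n}" and "T \<subseteq> S"
  shows "\<bar>offdiag_sum T B\<bar> \<le> norm_U n (restrict_mat S B)"
proof -
  let ?U = "restrict_mat T (\<lambda>i j. ones_mat i j - id_mat i j)"
  have "offdiag_sum T B = inner_mat n (restrict_mat S B) ?U"
    using inner_mat_test_mat[of S n T B] assms by (simp add: Int_absorb1)
  moreover have "?U \<in> test_mats n"
    using assms unfolding test_mats_def by auto
  ultimately show ?thesis
    unfolding norm_U_def using finite_test_mats by (auto intro!: cSUP_upper bdd_above_finite)
qed

lemma norm_U_restrict_le:
  assumes "S \<subseteq> {1..n}" and "\<And>T. T \<subseteq> S \<Longrightarrow> \<bar>offdiag_sum T B\<bar> \<le> t"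
  shows "norm_U n (restrict_mat S B) \<le> t"
  unfolding norm_U_def
proof (rule cSUP_least)
  fix U assume "U \<in> test_mats n"
  then obtain T where "T \<subseteq> {1..n}" "U = restrict_mat T (\<lambda>i j. ones_mat i j - id_mat i j)"
    unfolding test_mats_def by auto
  then show "\<bar>inner_mat n (restrict_mat S B) U\<bar> \<le> t"
    using assms by (simp add: inner_mat_test_mat)
qed (rule test_mats_nonempty)

lemma offdiag_sum_shift:
  assumes "finite T"
  shows "offdiag_sum T (\<lambda>i j. A i j - q)
           = offdiag_sum T (\<lambda>i j. A i j - p) + real (card T) * (real (card T) - 1) * (p - q)"
proof -
  have "(\<Sum>j\<in>T - {i}. A i j - q) = (\<Sum>j\<in>T - {i}. A i j - p) + (real (card T) - 1) * (p - q)"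
    if "i \<in> T" for i
  proof -
    have "card T \<ge> 1" using assms that by (metis One_nat_def Suc_leI card_gt_0_iff empty_iff)
    then show ?thesis
      using that assms by (simp add: sum_subtractf card_Diff_singleton of_nat_diff algebra_simps)
  qed
  then have "offdiag_sum T (\<lambda>i j. A i j - q)
      = (\<Sum>i\<in>T. (\<Sum>j\<in>T - {i}. A i j - p) + (real (card T) - 1) * (p - q))"
    unfolding offdiag_sum_def by (intro sum.cong refl)
  then show ?thesis
    unfolding offdiag_sum_def by (simp only: sum.distrib sum_constant mult.assoc)
qed

lemma offdiag_sum_p_hat_on:
  assumes "finite S" and "card S \<ge> 2" and "\<And>i. A i i = 0"
  shows "offdiag_sum S (\<lambda>i j. A i j - p_hat_on A S) = 0"
proof -
  have "offdiag_sum S A = (\<Sum>i\<in>S. \<Sum>j\<in>S. A i j)"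
    unfolding offdiag_sum_def using assms(1,3) by (intro sum.cong refl sum.mono_neutral_left) auto
  moreover have "real (card S) * (real (card S) - 1) \<noteq> 0"
    using assms(2) by auto
  ultimately show ?thesis
    using offdiag_sum_shift[OF assms(1), of A "p_hat_on A S" 0]
    by (simp add: p_hat_on_def)
qed

lemma pairs_count_nonneg: "0 \<le> real k * (real k - 1)"
  by (cases "k = 0") auto

text \<open>The deterministic core: uniform concentration over the subsets of one large set \<open>G\<close>
  controls the estimator, whatever the entries of \<open>A\<close> outside \<open>G \<times> G\<close> are. The bound \<open>n \<ge> 5\<close>
  ensures \<open>k (k - 1) \<ge> n\<^sup>2 / 4\<close> for \<open>k \<ge> 5n/8\<close>.\<close>

lemma p_hat_error_bound:
  fixes p t :: real
  assumes \<S>: "minimizer_rule n \<S>" and A: "adjacency n A" and "n \<ge> 5"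
    and G: "G \<subseteq> {1..n}" "real (card G) \<ge> 7 * real n / 8"
    and t: "\<And>T. T \<subseteq> G \<Longrightarrow> \<bar>offdiag_sum T (\<lambda>i j. A i j - p)\<bar> \<le> t"
  shows "\<bar>p_hat \<S> A - p\<bar> \<le> 12 * t / (real n)\<^sup>2"
proof -
  let ?N = "\<lambda>S. norm_U n (restrict_mat S (\<lambda>i j. A i j - p_hat_on A S))"
  let ?m = "\<lambda>T. real (card T) * (real (card T) - 1)"
  have diag: "A i i = 0" for i using A unfolding adjacency_def by auto
  define S where "S = \<S> A"
  define q where "q = p_hat_on A S"
  have S: "S \<subseteq> {1..n}" "real (card S) \<ge> 3 * real n / 4" and min: "?N S \<le> ?N G"
    using \<S> A G unfolding minimizer_rule_def S_def is_arg_min_linorder ones_mat_def by auto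
  have fin: "finite G" "finite S" using G S finite_subset by blast+
  have "card G \<ge> 2" using G(2) \<open>n \<ge> 5\<close> by linarith
  have pG: "?m G * \<bar>p - p_hat_on A G\<bar> \<le> t"
  proof -
    have "offdiag_sum G (\<lambda>i j. A i j - p) + ?m G * (p - p_hat_on A G) = 0"
      using offdiag_sum_p_hat_on[of G A] offdiag_sum_shift[of G A "p_hat_on A G" p] fin diag \<open>card G \<ge> 2\<close>
      by simp
    then have "\<bar>?m G * (p - p_hat_on A G)\<bar> \<le> t" using t[of G] by simp
    then show ?thesis using \<open>card G \<ge> 2\<close> by (simp add: abs_mult)
  qed
  have "?N G \<le> 2 * t"
  proof (rule norm_U_restrict_le[OF G(1)])
    fix T assume T: "T \<subseteq> G"
    have "card T \<le> card G" using T fin by (simp add: card_mono)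
    have "?m T \<le> ?m G"
    proof (cases "card T = 0")
      case True
      then show ?thesis using \<open>card G \<ge> 2\<close> by simp
    next
      case False
      then show ?thesis using \<open>card T \<le> card G\<close> by (intro mult_mono) auto
    qed
    then have "?m T * \<bar>p - p_hat_on A G\<bar> \<le> t"
      using pG mult_right_mono[of "?m T" "?m G" "\<bar>p - p_hat_on A G\<bar>"] by linarith
    then have "\<bar>?m T * (p - p_hat_on A G)\<bar> \<le> t"
      unfolding abs_mult[of "?m T"] abs_of_nonneg[OF pairs_count_nonneg] .
    then show "\<bar>offdiag_sum T (\<lambda>i j. A i j - p_hat_on A G)\<bar> \<le> 2 * t"
      using t[OF T] finite_subset[OF T fin(1)] by (simp add: offdiag_sum_shift[of T A "p_hat_on A G" p])
  qed
  \<comment> \<open>the test set seen both by the objective at \<open>S\<close> and by the concentration on \<open>G\<close>\<close>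
  define T where "T = S \<inter> G"
  have fT: "finite T" using fin unfolding T_def by simp
  have "card S + card G = card (S \<union> G) + card T"
    unfolding T_def using fin(2,1) by (rule card_Un_Int)
  moreover have "card (S \<union> G) \<le> card {1..n}"
    using S G by (intro card_mono) auto
  ultimately have cT: "real (card T) \<ge> 5 * real n / 8"
    using S(2) G(2) by simp
  have "\<bar>offdiag_sum T (\<lambda>i j. A i j - q)\<bar> \<le> ?N S"
    unfolding q_def by (rule offdiag_sum_le_norm_U[OF S(1)]) (simp add: T_def)
  then have "?m T * \<bar>p - q\<bar> \<le> 3 * t"
    using offdiag_sum_shift[OF fT, of A q p] min \<open>?N G \<le> 2 * t\<close> t[of T]
      abs_mult[of "?m T" "p - q"] abs_of_nonneg[OF pairs_count_nonneg, of "card T"]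
    by (simp add: T_def)
  moreover have mT: "?m T \<ge> (real n)\<^sup>2 / 4"
  proof -
    have "?m T \<ge> (5 * real n / 8) * (5 * real n / 8 - 1)"
      using cT \<open>n \<ge> 5\<close> by (intro mult_mono) auto
    moreover have "real n * real n \<ge> 5 * real n"
      using \<open>n \<ge> 5\<close> by (intro mult_right_mono) auto
    ultimately show ?thesis by (simp add: power2_eq_square algebra_simps)
  qed
  ultimately have "(real n)\<^sup>2 / 4 * \<bar>p - q\<bar> \<le> 3 * t"
    using mult_right_mono[OF mT, of "\<bar>p - q\<bar>"] by simp
  then show ?thesis
    using \<open>n \<ge> 5\<close> unfolding p_hat_def q_def[symmetric] S_def[symmetric]
    by (simp add: field_simps abs_minus_commute)
qed

section \<open>Concentration of the clean part of the graph\<close>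

lemma offdiag_sum_mat_of_edges:
  assumes "finite T"
  shows "offdiag_sum T (\<lambda>i j. mat_of_edges E i j - p)
           = 2 * (\<Sum>e\<in>{(i, j). i \<in> T \<and> j \<in> T \<and> i < j}. of_bool (E e) - p)"
proof -
  define U where "U = {(i, j). i \<in> T \<and> j \<in> T \<and> i < j}"
  let ?B = "\<lambda>(i, j). mat_of_edges E i j - p"
  have "finite U"
    using assms by (intro finite_subset[of U "T \<times> T"]) (auto simp: U_def)
  have upper: "sum ?B U = (\<Sum>e\<in>U. of_bool (E e) - p)"
    by (intro sum.cong) (auto simp: U_def mat_of_edges_def)
  have lower: "sum ?B (prod.swap ` U) = (\<Sum>e\<in>U. of_bool (E e) - p)"
    by (subst sum.reindex) (auto intro!: sum.cong simp: U_def mat_of_edges_def)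
  have "offdiag_sum T (\<lambda>i j. mat_of_edges E i j - p) = sum ?B (Sigma T (\<lambda>i. T - {i}))"
    unfolding offdiag_sum_def using assms by (simp add: sum.Sigma)
  also have "Sigma T (\<lambda>i. T - {i}) = U \<union> prod.swap ` U"
    by (force simp: U_def image_iff)
  also have "sum ?B \<dots> = sum ?B U + sum ?B (prod.swap ` U)"
    using \<open>finite U\<close> by (intro sum.union_disjoint) (auto simp: U_def)
  finally show ?thesis
    unfolding upper lower U_def[symmetric] by simp
qed

lemma finite_pairs: "finite (pairs n)"
  by (rule finite_subset[of _ "{1..n} \<times> {1..n}"]) (auto simp: pairs_def)

lemma rate_bounds:
  assumes "n \<ge> 1" and "p \<in> {0..1}"
  shows "1 \<le> real n * rate n p" and "real n * (p * (1 - p)) \<le> (real n * rate n p)\<^sup>2"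
proof -
  have nn: "0 \<le> p * (1 - p)" using assms by simp
  have eq: "real n * rate n p = real n * sqrt (p * (1 - p) / real n) + 1"
    using assms by (simp add: rate_def field_simps)
  show "1 \<le> real n * rate n p" unfolding eq using nn by simp
  have "real n * (p * (1 - p)) = (real n * sqrt (p * (1 - p) / real n))\<^sup>2"
    unfolding power_mult_distrib using assms nn by (simp add: power2_eq_square)
  also have "\<dots> \<le> (real n * rate n p)\<^sup>2"
    unfolding eq using nn by (intro power_mono) auto
  finally show "real n * (p * (1 - p)) \<le> (real n * rate n p)\<^sup>2" .
qed

text \<open>
  With \<open>l = 1 / (n \<cdot> rate n p)\<close>, the lower bounds on \<open>n \<cdot> rate n p\<close> give \<open>l \<le> 1\<close> and make the variance
  term in the exponent at most \<open>n\<close>, while the deviation term is \<open>4n\<close>: each set fails with probability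
  at most \<open>2 exp (- 3n)\<close>, and \<open>2^n \<cdot> 2 \<le> exp (2n)\<close> pays for the union bound.
\<close>

lemma clean_subgraphs_concentrate:
  fixes P :: "nat \<times> nat \<Rightarrow> bool pmf"
  assumes n: "n \<ge> 1" and p: "p \<in> {0..1}" and G: "G \<subseteq> {1..n}"
    and P: "\<And>i j. i \<in> G \<Longrightarrow> j \<in> G \<Longrightarrow> P (i, j) = bernoulli_pmf p"
  shows "measure_pmf.prob (Pi_pmf (pairs n) False P)
           {E. \<exists>T\<subseteq>G. 8 * (real n)\<^sup>2 * rate n p < \<bar>offdiag_sum T (\<lambda>i j. mat_of_edges E i j - p)\<bar>}
         \<le> exp (- real n)"
    (is "measure_pmf.prob ?M ?X \<le> _")
proof -
  define r where "r = real n * rate n p"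
  define D where "D = (\<lambda>T. {(i, j). i \<in> T \<and> j \<in> T \<and> i < (j::nat)})"
  define bad where "bad = (\<lambda>T. {E. 4 * real n \<le> (1 / r) * \<bar>\<Sum>e\<in>D T. of_bool (E e) - p\<bar>})"
  have r: "1 \<le> r" "real n * (p * (1 - p)) \<le> r\<^sup>2"
    unfolding r_def using rate_bounds[OF n p] by auto
  have "finite G" using G finite_subset by blast
  have bad_le: "measure_pmf.prob ?M (bad T) \<le> 2 * exp (- (3 * real n))" if T: "T \<subseteq> G" for T
  proof -
    have sub: "D T \<subseteq> pairs n" using T G unfolding D_def pairs_def by fastforce
    have "D T \<subseteq> {1..n} \<times> {1..n}" using T G unfolding D_def by auto
    then have "card (D T) \<le> n * n"
      using card_mono[of "{1..n} \<times> {1..n}" "D T"] by simp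
    then have cD: "real (card (D T)) \<le> real n * real n"
      by (metis of_nat_le_iff of_nat_mult)
    have "real (card (D T)) * (p * (1 - p)) \<le> real n * real n * (p * (1 - p))"
      using cD p by (intro mult_right_mono) auto
    also have "\<dots> \<le> real n * r\<^sup>2"
      using r(2) by (simp add: mult_left_mono mult.assoc)
    finally have "(1 / r)\<^sup>2 * (real (card (D T)) * (p * (1 - p))) \<le> real n"
      using r(1) by (simp add: power_divide field_simps)
    moreover have "measure_pmf.prob ?M (bad T)
        \<le> 2 * exp ((1 / r)\<^sup>2 * (real (card (D T)) * (p * (1 - p))) - 4 * real n)"
      unfolding bad_def
      by (rule Pi_pmf_bernoulli_abs_tail)
         (use r(1) p sub subsetD[OF T] P finite_pairs in \<open>auto simp: D_def\<close>)
    ultimately show ?thesis by (smt (verit) exp_le_cancel_iff)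
  qed
  have "?X \<subseteq> (\<Union>T\<in>Pow G. bad T)"
  proof
    fix E assume "E \<in> ?X"
    then obtain T where T: "T \<subseteq> G"
      and "8 * (real n)\<^sup>2 * rate n p < \<bar>offdiag_sum T (\<lambda>i j. mat_of_edges E i j - p)\<bar>"
      by auto
    then have "8 * (real n * r) < 2 * \<bar>\<Sum>e\<in>D T. of_bool (E e) - p\<bar>"
      using offdiag_sum_mat_of_edges[of T E p] finite_subset[OF T \<open>finite G\<close>]
      by (simp add: D_def r_def power2_eq_square abs_mult mult_ac)
    then have "E \<in> bad T"
      using r(1) by (auto simp: bad_def field_simps)
    then show "E \<in> (\<Union>T\<in>Pow G. bad T)"
      using T by blast
  qed
  then have "measure_pmf.prob ?M ?X \<le> measure_pmf.prob ?M (\<Union>T\<in>Pow G. bad T)"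
    by (intro measure_pmf.finite_measure_mono) auto
  also have "\<dots> \<le> (\<Sum>T\<in>Pow G. measure_pmf.prob ?M (bad T))"
    using \<open>finite G\<close> by (intro measure_UNION_le) auto
  also have "\<dots> \<le> (\<Sum>T\<in>Pow G. 2 * exp (- (3 * real n)))"
    by (intro sum_mono bad_le) auto
  also have "\<dots> = 2 ^ card G * (2 * exp (- (3 * real n)))"
    using \<open>finite G\<close> by (simp add: card_Pow)
  also have "\<dots> \<le> exp (real n) * (exp (real n) * exp (- (3 * real n)))"
  proof (intro mult_mono)
    have "card G \<le> n" using card_mono[OF _ G] by simp
    then have "(2::real) ^ card G \<le> 2 ^ n" by (intro power_increasing) auto
    also have "\<dots> \<le> exp 1 ^ n"
      using exp_ge_add_one_self[of 1] by (intro power_mono) auto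
    also have "\<dots> = exp (real n)" by (simp flip: exp_of_nat_mult)
    finally show "2 ^ card G \<le> exp (real n)" .
    show "2 \<le> exp (real n)" using exp_ge_add_one_self[of "real n"] n by linarith
  qed auto
  also have "\<dots> = exp (- real n)" by (simp flip: exp_add)
  finally show ?thesis .
qed

lemma few_contaminated:
  fixes \<epsilon> :: real
  assumes "0 \<le> \<epsilon>" and "\<epsilon> \<le> 1 / 100"
  shows "measure_pmf.prob (Pi_pmf {1..n} False (\<lambda>_. bernoulli_pmf \<epsilon>))
           {z. real (card {i\<in>{1..n}. \<not> z i}) < 7 * real n / 8} \<le> exp (- (real n / 10))"
    (is "measure_pmf.prob ?M ?X \<le> _")
proof -
  \<comment> \<open>\<open>1/8 - 1/100 = 23/200\<close>: a lower bound on the excess over the mean (at most \<open>n/100\<close>) when more than \<open>n/8\<close> nodes are contaminated\<close>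
  let ?a = "23 * real n / 200"
  have "?X \<subseteq> {z. ?a \<le> 1 * (\<Sum>i\<in>{1..n}. of_bool (z i) - \<epsilon>)}"
  proof
    fix z assume "z \<in> ?X"
    have "(\<Sum>i\<in>{1..n}. of_bool (z i) - \<epsilon>) = real (card {i\<in>{1..n}. z i}) - real n * \<epsilon>"
      by (simp add: sum_subtractf Int_def)
    moreover have "real (card {i\<in>{1..n}. \<not> z i}) < 7 * real n / 8"
      using \<open>z \<in> ?X\<close> by simp
    moreover have "real (card {i\<in>{1..n}. z i}) + real (card {i\<in>{1..n}. \<not> z i}) = real n"
    proof -
      have "card ({i\<in>{1..n}. z i} \<union> {i\<in>{1..n}. \<not> z i}) = card {i\<in>{1..n}. z i} + card {i\<in>{1..n}. \<not> z i}"
        by (intro card_Un_disjoint) auto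
      moreover have "{i\<in>{1..n}. z i} \<union> {i\<in>{1..n}. \<not> z i} = {1..n}" by auto
      ultimately show ?thesis by (metis card_atLeastAtMost diff_Suc_1 of_nat_add)
    qed
    moreover have "real n * \<epsilon> \<le> real n * (1 / 100)" using assms by (intro mult_left_mono) auto
    ultimately show "z \<in> {z. ?a \<le> 1 * (\<Sum>i\<in>{1..n}. of_bool (z i) - \<epsilon>)}"
      unfolding mem_Collect_eq mult_1 by linarith
  qed
  then have "measure_pmf.prob ?M ?X \<le> measure_pmf.prob ?M {z. ?a \<le> 1 * (\<Sum>i\<in>{1..n}. of_bool (z i) - \<epsilon>)}"
    by (intro measure_pmf.finite_measure_mono) auto
  also have "\<dots> \<le> exp (1\<^sup>2 * (real (card {1..n}) * (\<epsilon> * (1 - \<epsilon>))) - ?a)"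
    using assms by (intro Pi_pmf_bernoulli_tail) auto
  also have "\<dots> \<le> exp (- (real n / 10))"
  proof -
    have "\<epsilon> * (1 - \<epsilon>) \<le> 1 / 100 * 1" using assms by (intro mult_mono) auto
    then have "real n * (\<epsilon> * (1 - \<epsilon>)) \<le> real n * (1 / 100)" by (intro mult_left_mono) auto
    then show ?thesis by simp
  qed
  finally show ?thesis .
qed

lemma prob_bind_pmf_le:
  assumes Z: "measure_pmf.prob M Z \<le> a" and f: "\<And>z. z \<notin> Z \<Longrightarrow> measure_pmf.prob (f z) X \<le> b"
    and "0 \<le> b"
  shows "measure_pmf.prob (bind_pmf M f) X \<le> a + b"
proof -
  have "0 \<le> a" using Z by (meson measure_nonneg order_trans)
  have "emeasure (measure_pmf (bind_pmf M f)) X = (\<integral>\<^sup>+z. emeasure (f z) X \<partial>M)"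
    by simp
  also have "\<dots> \<le> (\<integral>\<^sup>+z. indicator Z z + ennreal b \<partial>M)"
  proof (intro nn_integral_mono)
    fix z
    show "emeasure (f z) X \<le> indicator Z z + ennreal b"
    proof (cases "z \<in> Z")
      case True
      have "emeasure (f z) X \<le> 1" by (rule measure_pmf.emeasure_le_1)
      also have "1 \<le> 1 + ennreal b" by simp
      finally show ?thesis using True by simp
    next
      case False
      then show ?thesis using f[OF False] by (simp add: measure_pmf.emeasure_eq_measure ennreal_leI)
    qed
  qed
  also have "\<dots> = emeasure M Z + ennreal b"
    by (subst nn_integral_add) auto
  also have "\<dots> \<le> ennreal a + ennreal b"
    using Z by (simp add: measure_pmf.emeasure_eq_measure ennreal_leI)
  also have "\<dots> = ennreal (a + b)"
    using \<open>0 \<le> a\<close> \<open>0 \<le> b\<close> by (rule ennreal_plus[symmetric])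
  finally show ?thesis
    using \<open>0 \<le> a\<close> \<open>0 \<le> b\<close> by (simp add: measure_pmf.emeasure_eq_measure del: ennreal_plus)
qed

lemma adjacency_mat_of_edges:
  assumes "E \<in> set_pmf (Pi_pmf (pairs n) False P)"
  shows "adjacency n (mat_of_edges E)"
proof -
  have "\<not> E e" if "e \<notin> pairs n" for e
    using assms set_Pi_pmf_subset[OF finite_pairs, of n False P] that by (cases e) auto
  then show ?thesis
    by (fastforce simp: adjacency_def mat_of_edges_def pairs_def)
qed

lemma p_hat_deviation_prob:
  assumes \<S>: "minimizer_rule n \<S>" and n: "n \<ge> 5" and p: "p \<in> {0..1}"
    and \<epsilon>: "0 \<le> \<epsilon>" "\<epsilon> \<le> 1 / 100" and P: "P \<in> ER_class n p \<epsilon>"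
  shows "measure_pmf.prob P {A. \<not> \<bar>p_hat \<S> A - p\<bar> \<le> 96 * rate n p}
           \<le> exp (- (real n / 10)) + exp (- real n)"
proof -
  obtain q where P_eq: "P = contaminated_ER n p \<epsilon> q"
    using P unfolding ER_class_def by auto
  let ?G = "\<lambda>z. {i\<in>{1..n}. \<not> z i}" and ?bad = "{A. \<not> \<bar>p_hat \<S> A - p\<bar> \<le> 96 * rate n p}"
  show ?thesis
    unfolding P_eq contaminated_ER_def
  proof (rule prob_bind_pmf_le[OF few_contaminated[OF \<epsilon>]])
    fix z assume z: "z \<notin> {z. real (card (?G z)) < 7 * real n / 8}"
    let ?Q = "\<lambda>(i, j). bernoulli_pmf (if \<not> z i \<and> \<not> z j then p else q z i j)"
    let ?M = "Pi_pmf (pairs n) False ?Q"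
    let ?t = "8 * (real n)\<^sup>2 * rate n p"
    let ?X = "{E. \<exists>T\<subseteq>?G z. ?t < \<bar>offdiag_sum T (\<lambda>i j. mat_of_edges E i j - p)\<bar>}"
    have "E \<in> ?X" if E: "E \<in> set_pmf ?M" "mat_of_edges E \<in> ?bad" for E
    proof (rule ccontr)
      assume "E \<notin> ?X"
      then have "\<bar>p_hat \<S> (mat_of_edges E) - p\<bar> \<le> 12 * ?t / (real n)\<^sup>2"
        using z by (intro p_hat_error_bound[OF \<S> adjacency_mat_of_edges[OF E(1)] n, of "?G z"])
          (auto simp: not_less)
      then show False using E(2) n by simp
    qed
    then have "measure_pmf.prob ?M (mat_of_edges -` ?bad) \<le> measure_pmf.prob ?M ?X"
      by (intro measure_pmf.finite_measure_mono_AE) (auto simp: AE_measure_pmf_iff)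
    also have "\<dots> \<le> exp (- real n)"
      using n p by (intro clean_subgraphs_concentrate) auto
    finally show "measure_pmf.prob (map_pmf mat_of_edges ?M) ?bad \<le> exp (- real n)"
      by simp
  qed simp
qed

section \<open>Length of the confidence interval\<close>

lemma CI_hat_subset_interval:
  assumes n: "n \<ge> 1" and p: "p \<in> {0..1}" and C: "0 \<le> C" and close: "\<bar>p_hat \<S> A - p\<bar> \<le> C * rate n p"
  shows "CI_hat n C \<S> A \<subseteq> {p - (4 * C + C\<^sup>2) * rate n p .. p + (4 * C + C\<^sup>2) * rate n p}"
proof
  fix x assume "x \<in> CI_hat n C \<S> A"
  then have x: "x \<in> {0..1}" and cx: "\<bar>p_hat \<S> A - x\<bar> \<le> C * rate n x"
    unfolding CI_hat_def by auto
  define d where "d = \<bar>x - p\<bar>"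
  let ?s = "\<lambda>y. sqrt (y * (1 - y) / real n)"
  have "0 \<le> d" by (simp add: d_def)
  have "?s x \<le> sqrt (p * (1 - p) / real n + d / real n)"
  proof -
    have "x * (1 - x) - p * (1 - p) = (x - p) * (1 - x - p)" by (simp add: algebra_simps)
    also have "\<dots> \<le> \<bar>x - p\<bar> * \<bar>1 - x - p\<bar>" by (metis abs_ge_self abs_mult)
    also have "\<dots> \<le> \<bar>x - p\<bar> * 1" using x p by (intro mult_left_mono) auto
    finally have "x * (1 - x) \<le> p * (1 - p) + d" by (simp add: d_def)
    then show ?thesis by (simp add: add_divide_distrib[symmetric] divide_right_mono)
  qed
  also have "\<dots> \<le> ?s p + sqrt (d / real n)"
    using p \<open>0 \<le> d\<close> by (intro sqrt_add_le_add_sqrt) auto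
  finally have s: "rate n x \<le> rate n p + sqrt (d / real n)" by (simp add: rate_def)
  have "d \<le> C * rate n x + C * rate n p" using cx close unfolding d_def by linarith
  also have "\<dots> \<le> C * (rate n p + sqrt (d / real n)) + C * rate n p"
    using s C by (intro add_mono mult_left_mono) auto
  finally have d1: "d \<le> 2 * C * rate n p + C * sqrt (d / real n)" by (simp add: algebra_simps)
  \<comment> \<open>the arithmetic-geometric mean inequality lets \<open>d\<close> be absorbed on the left\<close>
  have "2 * (C * sqrt (d / real n)) \<le> d + C\<^sup>2 / real n"
  proof -
    have "0 \<le> (sqrt d - C / sqrt (real n))\<^sup>2" by simp
    also have "\<dots> = d + C\<^sup>2 / real n - 2 * (C * sqrt (d / real n))"
      using \<open>0 \<le> d\<close> by (simp add: power2_diff power_divide real_sqrt_divide)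
    finally show ?thesis by simp
  qed
  with d1 have "d \<le> 4 * C * rate n p + C\<^sup>2 * (1 / real n)" by simp
  also have "\<dots> \<le> 4 * C * rate n p + C\<^sup>2 * rate n p"
    using p C by (intro add_mono mult_left_mono) (auto simp: rate_def)
  finally show "x \<in> {p - (4 * C + C\<^sup>2) * rate n p .. p + (4 * C + C\<^sup>2) * rate n p}"
    unfolding d_def by (simp add: algebra_simps abs_le_iff)
qed

text \<open>No measurability of \<open>X\<close> is required: the measure of a non-measurable set is 0.\<close>

lemma CI_length_mono_interval:
  assumes "X \<subseteq> {a..b}" and "a \<le> b"
  shows "CI_length X \<le> b - a"
proof (cases "X \<in> sets lborel")
  case True
  then have "measure lborel X \<le> measure lborel {a..b}"
    using assms by (intro measure_mono_fmeasurable) (auto simp: fmeasurable_def)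
  then show ?thesis using assms by (simp add: CI_length_def)
next
  case False
  then show ?thesis using assms by (simp add: CI_length_def measure_notin_sets)
qed

lemma CI_length_bound:
  assumes "n \<ge> 1" and p: "p \<in> {0..1}" and C: "0 \<le> C" and "\<bar>p_hat \<S> A - p\<bar> \<le> C * rate n p"
  shows "CI_length (CI_hat n C \<S> A) \<le> 2 * (4 * C + C\<^sup>2) * rate n p"
proof -
  have "0 \<le> rate n p" using p by (simp add: rate_def)
  then have "0 \<le> (4 * C + C\<^sup>2) * rate n p" using C by simp
  then show ?thesis
    using CI_length_mono_interval[OF CI_hat_subset_interval[OF assms]] by (simp add: algebra_simps)
qed

section \<open>Honest and adaptive inference for the edge probability\<close>

lemma p_hat_close_prob:
  assumes \<S>: "minimizer_rule n \<S>" and "n \<ge> 1" and \<alpha>: "0 < \<alpha>" "\<alpha> < 1"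
    and c: "ln (2 / \<alpha>) / real n + \<epsilon>' \<le> 1 / 100"
    and p: "p \<in> {0..1}" and \<epsilon>: "0 \<le> \<epsilon>" "\<epsilon> \<le> \<epsilon>'" and P: "P \<in> ER_class n p \<epsilon>"
  shows "1 - \<alpha> \<le> measure_pmf.prob P {A. \<bar>p_hat \<S> A - p\<bar> \<le> 96 * rate n p}"
proof -
  have ln_half: "ln (2 / \<alpha>) \<ge> 1 / 2"
  proof -
    have "ln 2 \<le> ln (2 / \<alpha>)" using \<alpha> by (simp add: field_simps)
    moreover have "1 / 2 \<le> ln (2::real)"
      by (rule iffD2[OF ln_ge_iff exp_half_le2]) simp
    ultimately show ?thesis by linarith
  qed
  then have "0 \<le> ln (2 / \<alpha>) / real n" by simp
  then have \<epsilon>_le: "\<epsilon> \<le> 1 / 100" using c \<epsilon> by linarith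
  have "ln (2 / \<alpha>) / real n \<le> 1 / 100" using c \<epsilon> by linarith
  then have ln_le: "ln (2 / \<alpha>) \<le> real n / 100"
    using \<open>n \<ge> 1\<close> by (simp add: field_simps)
  then have n: "n \<ge> 5" using ln_half by linarith
  have exp_le: "exp (- y) \<le> \<alpha> / 2" if "real n / 10 \<le> y" for y
  proof -
    have "exp (- y) \<le> exp (- ln (2 / \<alpha>))" using that ln_le by simp
    also have "\<dots> = \<alpha> / 2" using \<alpha> by (simp add: exp_minus)
    finally show ?thesis .
  qed
  have "measure_pmf.prob P {A. \<not> \<bar>p_hat \<S> A - p\<bar> \<le> 96 * rate n p}
      \<le> exp (- (real n / 10)) + exp (- real n)"
    by (rule p_hat_deviation_prob[OF \<S> n p \<epsilon>(1) \<epsilon>_le P])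
  also have "\<dots> \<le> \<alpha> / 2 + \<alpha> / 2"
    by (intro add_mono exp_le) auto
  finally show ?thesis
    using measure_pmf.prob_neg[of P "\<lambda>A. \<bar>p_hat \<S> A - p\<bar> \<le> 96 * rate n p"] by simp
qed

lemma ER_class_nonempty: "ER_class n p \<epsilon> \<noteq> {}"
proof -
  have "contaminated_ER n p \<epsilon> (\<lambda>_ _ _. 0) \<in> ER_class n p \<epsilon>"
    unfolding ER_class_def by (auto intro!: exI[of _ "\<lambda>_ _ _. 0"])
  then show ?thesis by blast
qed

theorem theorem9:
  "\<exists>c0::real. c0 > 0 \<and>
    (\<forall>\<alpha>::real. 0 < \<alpha> \<and> \<alpha> < 1 \<longrightarrow>
      (\<exists>C C'::real. C > 0 \<and> C' > 0 \<and>
        (\<forall>(n::nat) (\<epsilon>max::real) \<S>.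
          n \<ge> 1 \<and> \<epsilon>max \<in> {0..1} \<and> ln (2 / \<alpha>) / real n + \<epsilon>max \<le> c0 \<and> minimizer_rule n \<S> \<longrightarrow>
            (INF p\<in>{0..1}. INF P\<in>ER_class n p \<epsilon>max.
               measure_pmf.prob P {A. \<bar>p_hat \<S> A - p\<bar> \<le> C * rate n p}) \<ge> 1 - \<alpha> \<and>
            (INF p\<in>{0..1}. INF P\<in>ER_class n p \<epsilon>max.
               measure_pmf.prob P {A. p \<in> CI_hat n C \<S> A}) \<ge> 1 - \<alpha> \<and>
            (INF (\<epsilon>, p)\<in>{0..\<epsilon>max} \<times> {0..1}. INF P\<in>ER_class n p \<epsilon>.
               measure_pmf.prob P {A. CI_length (CI_hat n C \<S> A) \<le> C' * rate n p}) \<ge> 1 - \<alpha>)))"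
proof (rule exI[of _ "1 / 100"], intro conjI allI impI)
  fix \<alpha> :: real assume \<alpha>: "0 < \<alpha> \<and> \<alpha> < 1"
  show "\<exists>C C'::real. C > 0 \<and> C' > 0 \<and>
        (\<forall>(n::nat) (\<epsilon>max::real) \<S>.
          n \<ge> 1 \<and> \<epsilon>max \<in> {0..1} \<and> ln (2 / \<alpha>) / real n + \<epsilon>max \<le> 1 / 100 \<and> minimizer_rule n \<S> \<longrightarrow>
            (INF p\<in>{0..1}. INF P\<in>ER_class n p \<epsilon>max.
               measure_pmf.prob P {A. \<bar>p_hat \<S> A - p\<bar> \<le> C * rate n p}) \<ge> 1 - \<alpha> \<and>
            (INF p\<in>{0..1}. INF P\<in>ER_class n p \<epsilon>max.
               measure_pmf.prob P {A. p \<in> CI_hat n C \<S> A}) \<ge> 1 - \<alpha> \<and>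
            (INF (\<epsilon>, p)\<in>{0..\<epsilon>max} \<times> {0..1}. INF P\<in>ER_class n p \<epsilon>.
               measure_pmf.prob P {A. CI_length (CI_hat n C \<S> A) \<le> C' * rate n p}) \<ge> 1 - \<alpha>)"
  proof (rule exI[of _ 96], rule exI[of _ "2 * (4 * 96 + 96\<^sup>2)"], intro conjI allI impI)
    fix n :: nat and \<epsilon>max :: real and \<S>
    assume asm: "n \<ge> 1 \<and> \<epsilon>max \<in> {0..1} \<and> ln (2 / \<alpha>) / real n + \<epsilon>max \<le> 1 / 100 \<and> minimizer_rule n \<S>"
    then have n: "n \<ge> 1" and \<epsilon>max: "0 \<le> \<epsilon>max" by auto
    have close: "1 - \<alpha> \<le> measure_pmf.prob P {A. \<bar>p_hat \<S> A - p\<bar> \<le> 96 * rate n p}"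
      if "\<epsilon> \<in> {0..\<epsilon>max}" "p \<in> {0..1}" "P \<in> ER_class n p \<epsilon>" for \<epsilon> p P
      using asm \<alpha> that by (intro p_hat_close_prob[of n \<S> \<alpha> \<epsilon>max p \<epsilon> P]) auto
    show "(INF p\<in>{0..1}. INF P\<in>ER_class n p \<epsilon>max.
        measure_pmf.prob P {A. \<bar>p_hat \<S> A - p\<bar> \<le> 96 * rate n p}) \<ge> 1 - \<alpha>"
      using close[of \<epsilon>max] \<epsilon>max by (intro cINF_greatest ER_class_nonempty) auto
    show "(INF p\<in>{0..1}. INF P\<in>ER_class n p \<epsilon>max.
        measure_pmf.prob P {A. p \<in> CI_hat n 96 \<S> A}) \<ge> 1 - \<alpha>"
      using close[of \<epsilon>max] \<epsilon>max
      by (intro cINF_greatest ER_class_nonempty) (auto simp: CI_hat_def)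
    have short: "1 - \<alpha> \<le> measure_pmf.prob P
        {A. CI_length (CI_hat n 96 \<S> A) \<le> 2 * (4 * 96 + 96\<^sup>2) * rate n p}"
      if "\<epsilon> \<in> {0..\<epsilon>max}" "p \<in> {0..1}" "P \<in> ER_class n p \<epsilon>" for \<epsilon> p P
    proof -
      have "measure_pmf.prob P {A. \<bar>p_hat \<S> A - p\<bar> \<le> 96 * rate n p}
          \<le> measure_pmf.prob P {A. CI_length (CI_hat n 96 \<S> A) \<le> 2 * (4 * 96 + 96\<^sup>2) * rate n p}"
        using CI_length_bound[OF n that(2), of 96 \<S>]
        by (intro measure_pmf.finite_measure_mono) auto
      with close[OF that] show ?thesis by linarith
    qed
    show "(INF (\<epsilon>, p)\<in>{0..\<epsilon>max} \<times> {0..1}. INF P\<in>ER_class n p \<epsilon>.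
        measure_pmf.prob P {A. CI_length (CI_hat n 96 \<S> A) \<le> 2 * (4 * 96 + 96\<^sup>2) * rate n p}) \<ge> 1 - \<alpha>"
    proof (rule cINF_greatest)
      show "{0..\<epsilon>max} \<times> {0..1::real} \<noteq> {}" using \<epsilon>max by auto
    next
      fix x assume "x \<in> {0..\<epsilon>max} \<times> {0..1::real}"
      then show "1 - \<alpha> \<le> (case x of (\<epsilon>, p) \<Rightarrow> INF P\<in>ER_class n p \<epsilon>.
          measure_pmf.prob P {A. CI_length (CI_hat n 96 \<S> A) \<le> 2 * (4 * 96 + 96\<^sup>2) * rate n p})"
        using short by (auto intro!: cINF_greatest ER_class_nonempty)
    qed
  qed simp_all
qed simp

end
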